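(* Let $k\ge 0$ and let $f_h$ be the DG approximation to $f$, i.e. the $f_h$-component of the solution of the semi-discrete scheme (S1)--(S3) described in the context, with $f_h(0)=\mathcal P_hf_0$, where $\mathcal P_h$ is the $L^2$-projection onto $\mathcal Z_h$. Then $$\int_\Omega f_h(t,x,v)\,dx\,dv=\int_\Omega f_0(x,v)\,dx\,dv\qquad\text{for all } t>0$$ (in the time interval on which the discrete solution is defined).
   Context: Continuous problem. Let $I=[0,L]$, $T>0$, $\epsilon>0$. The Vlasov--viscous Burgers' system is $$\partial_t f+v\,\partial_x f+\partial_v((u-v)f)=0\ \text{ in }(0,T]\times I\times\mathbb R,\qquad f(0,x,v)=f_0(x,v),$$ $$\partial_t u+u\,\partial_x u-\epsilon\,\partial_x^2u=\rho V-\rho u\ \text{ in }(0,T]\times I,\qquad u(0,x)=u_0(x),$$ with $f,u,u_x$ periodic in $x$ with period $L$, where $\rho=\int_{\mathbb R} f\,dv$ and $\rho V=\int_{\mathbb R} v f\,dv$. The initial datum $f_0$ is compactly supported, and $M>0$ is such that, with $J=[-M,M]$ and $\Omega=I\times J$, the supports of $f_0$ and of $f(t,\cdot,\cdot)$, $t\in(0,T]$, are contained in $\Omega$. Mesh and spaces. $I$ is partitioned into $I_i=[x_{i-1/2},x_{i+1/2}]$, $1\le i\le N_x$, and $J$ into $J_j=[v_{j-1/2},v_{j+1/2}]$, $1\le j\le N_v$; $T_{ij}=I_i\times J_j$. $X_h$ is the space of functions on $I$ whose restriction to each $I_i$ is a polynomial of degree $\le k$; $\mathcal Z_h$ is the space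 of functions on $\Omega$ whose restriction to each $T_{ij}$ is a polynomial of degree $\le k$ in each of $x$ and $v$. At an interior interface, $\phi^\pm$ denote the one-sided limits (in $x$ or in $v$), $[\![\phi]\!]=\phi^+-\phi^-$, $\{\phi\}=\frac12(\phi^++\phi^-)$; in $x$ all traces are extended periodically (the points $x_{1/2}$ and $x_{N_x+1/2}$ are identified). Semi-discrete scheme. Fix flux parameters $\lambda_1,\lambda_2>1/2$ and $\lambda\ge 1/2$. Put $\rho_h=\int_J f_h\,dv$, $\rho_hV_h=\int_J v f_h\,dv$. Find $(u_h(t),w_h(t),f_h(t))\in X_h\times X_h\times\mathcal Z_h$ with $$\text{(S1)}\quad (\partial_t f_h,\psi_h)+\sum_{i,j}\mathcal B^h_{ij}(u_h;f_h,\psi_h)=0\quad\forall\psi_h\in\mathcal Z_h,$$ $$\text{(S2)}\quad (\partial_t u_h,\phi_h)+a_h(u_h,\phi_h)+\sqrt\epsilon\,b_h(w_h,\phi_h)+(\rho_hu_h,\phi_h)=(\rho_hV_h,\phi_h)\quad\forall\phi_h\in X_h,$$ $$\text{(S3)}\quad (w_h,q_h)+\sqrt\epsilon\,b_h(u_h,q_h)=0\quad\forall q_h\in X_h,$$ with prescribed initial data $f_h(0)\in\mathcal Z_h$, $u_h(0)\in X_h$. Here $(\cdot,\cdot)$ is the $L^2$ inner product (on $\Omega$ or $I$), $$\mathcal B^h_{ij}(u_h;f_h,\psi_h)=-\int_{T_{ij}}v f_h\partial_x\psi_h-\int_{T_{ij}}f_h(u_h-v)\partial_v\psi_h+\int_{J_j}\big[(\widehat{vf_h}\psi_h^-)_{i+1/2,v}-(\widehat{vf_h}\psi_h^+)_{i-1/2,v}\big]dv+\int_{I_i}\big[(\widehat{(u_h-v)f_h}\psi_h^-)_{x,j+1/2}-(\widehat{(u_h-v)f_h}\psi_h^+)_{x,j-1/2}\big]dx,$$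 with fluxes $\widehat{vf_h}=\{vf_h\}+\frac{1-2\lambda_1}{2}|v|[\![f_h]\!]$ on vertical edges (periodic in $x$), $\widehat{(u_h-v)f_h}=\{(u_h-v)f_h\}+\frac{1-2\lambda_2}{2}|u_h-v|[\![f_h]\!]$ on interior horizontal edges and $\widehat{(u_h-v)f_h}=0$ on $v=\pm M$. Moreover $$a_h(u_h,\phi_h)=-\sum_{i=1}^{N_x}\int_{I_i}\tfrac{u_h^2}{2}\partial_x\phi_h\,dx-\sum_{i=0}^{N_x-1}\tfrac12\big(\widehat{u_h^2}[\![\phi_h]\!]\big)_{i+1/2},\qquad \widehat{u_h^2}=\tfrac13\big((u_h^+)^2+u_h^+u_h^-+(u_h^-)^2\big),$$ $$b_h(z,\phi_h)=\sum_{i=1}^{N_x}\int_{I_i}z\,\partial_x\phi_h\,dx+\sum_{i=0}^{N_x-1}\big(\widehat{z}\,[\![\phi_h]\!]\big)_{i+1/2}\quad (z=u_h\text{ or }z=w_h),$$ with $\widehat{w_h}=(1-\lambda)w_h^-+\lambda w_h^+$ and $\widehat{u_h}=\lambda u_h^-+(1-\lambda)u_h^+$. *)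

theory Defs
  imports "HOL-Analysis.Analysis" "HOL-Computational_Algebra.Polynomial"
begin

text \<open>
  A partition of an interval is given by its nodes: the node with half-integer index
  \<open>i + 1/2\<close> is \<open>X i\<close>, so that the cell number \<open>i\<close>, for \<open>1 \<le> i \<le> N\<close>, is
  \<open>{X (i - 1)..X i}\<close>.  No uniformity is required.
\<close>

definition mesh_partition :: "real \<Rightarrow> real \<Rightarrow> nat \<Rightarrow> (nat \<Rightarrow> real) \<Rightarrow> bool" where
  "mesh_partition a b N X \<longleftrightarrow>
     1 \<le> N \<and> X 0 = a \<and> X N = b \<and> strict_mono_on {0..N} X"

text \<open>
  Discontinuous piecewise polynomials are only constrained on the open cells: they are two-valued
  at the interfaces, where the scheme uses one-sided limits only, and the value that the
  underlying function takes there is irrelevant.  All integrals are with respect to the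
  (complete) measure \<open>lebesgue\<close>, so these values affect neither measurability nor integrals.
\<close>

definition Xh :: "nat \<Rightarrow> nat \<Rightarrow> (nat \<Rightarrow> real) \<Rightarrow> (real \<Rightarrow> real) set" where
  "Xh k Nx X = {\<phi>. \<forall>i\<in>{1..Nx}. \<exists>p :: real poly. degree p \<le> k \<and>
      (\<forall>x\<in>{X (i - 1)<..<X i}. \<phi> x = poly p x)}"

definition Zh :: "nat \<Rightarrow> nat \<Rightarrow> (nat \<Rightarrow> real) \<Rightarrow> nat \<Rightarrow> (nat \<Rightarrow> real)
    \<Rightarrow> (real \<Rightarrow> real \<Rightarrow> real) set" where
  "Zh k Nx X Nv V = {\<psi>. \<forall>i\<in>{1..Nx}. \<forall>j\<in>{1..Nv}. \<exists>c :: nat \<Rightarrow> nat \<Rightarrow> real.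
      \<forall>x\<in>{X (i - 1)<..<X i}. \<forall>v\<in>{V (j - 1)<..<V j}.
        \<psi> x v = (\<Sum>a\<le>k. \<Sum>b\<le>k. c a b * x ^ a * v ^ b)}"

definition inner_I :: "real \<Rightarrow> (real \<Rightarrow> real) \<Rightarrow> (real \<Rightarrow> real) \<Rightarrow> real" where
  "inner_I L \<phi> \<psi> = (LINT x:{0..L}|lebesgue. \<phi> x * \<psi> x)"

definition inner_\<Omega> :: "real \<Rightarrow> real \<Rightarrow> (real \<Rightarrow> real \<Rightarrow> real) \<Rightarrow> (real \<Rightarrow> real \<Rightarrow> real) \<Rightarrow> real" where
  "inner_\<Omega> L M \<phi> \<psi> = (LINT (x, v):{0..L} \<times> {-M..M}|lebesgue. \<phi> x v * \<psi> x v)"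

definition square_integrable_\<Omega> :: "real \<Rightarrow> real \<Rightarrow> (real \<Rightarrow> real \<Rightarrow> real) \<Rightarrow> bool" where
  "square_integrable_\<Omega> L M g \<longleftrightarrow>
     set_borel_measurable lebesgue ({0..L} \<times> {-M..M}) (\<lambda>(x, v). g x v) \<and>
     set_integrable lebesgue ({0..L} \<times> {-M..M}) (\<lambda>(x, v). (g x v)\<^sup>2)"

text \<open>\<open>p\<close> represents the orthogonal projection of \<open>g\<close> onto \<open>Zh\<close>; it is unique up to its values
  on the cell boundaries.\<close>

definition is_L2_projection :: "nat \<Rightarrow> real \<Rightarrow> real \<Rightarrow> nat \<Rightarrow> (nat \<Rightarrow> real) \<Rightarrow> nat \<Rightarrow> (nat \<Rightarrow> real)
    \<Rightarrow> (real \<Rightarrow> real \<Rightarrow> real) \<Rightarrow> (real \<Rightarrow> real \<Rightarrow> real) \<Rightarrow> bool" where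
  "is_L2_projection k L M Nx X Nv V g p \<longleftrightarrow>
     p \<in> Zh k Nx X Nv V \<and>
     (\<forall>\<psi>\<in>Zh k Nx X Nv V. inner_\<Omega> L M p \<psi> = inner_\<Omega> L M g \<psi>)"

definition trace_minus :: "(real \<Rightarrow> real) \<Rightarrow> real \<Rightarrow> real" where
  "trace_minus \<phi> y = Lim (at_left y) \<phi>"

definition trace_plus :: "(real \<Rightarrow> real) \<Rightarrow> real \<Rightarrow> real" where
  "trace_plus \<phi> y = Lim (at_right y) \<phi>"

text \<open>Periodic traces at the node \<open>X i\<close>, \<open>0 \<le> i \<le> N\<close>, where \<open>X 0\<close> and \<open>X N\<close> are identified.\<close>

definition ptrace_minus :: "nat \<Rightarrow> (nat \<Rightarrow> real) \<Rightarrow> (real \<Rightarrow> real) \<Rightarrow> nat \<Rightarrow> real" where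
  "ptrace_minus N X \<phi> i = trace_minus \<phi> (if i = 0 then X N else X i)"

definition ptrace_plus :: "nat \<Rightarrow> (nat \<Rightarrow> real) \<Rightarrow> (real \<Rightarrow> real) \<Rightarrow> nat \<Rightarrow> real" where
  "ptrace_plus N X \<phi> i = trace_plus \<phi> (if i = N then X 0 else X i)"

definition pjump :: "nat \<Rightarrow> (nat \<Rightarrow> real) \<Rightarrow> (real \<Rightarrow> real) \<Rightarrow> nat \<Rightarrow> real" where
  "pjump N X \<phi> i = ptrace_plus N X \<phi> i - ptrace_minus N X \<phi> i"

definition paverage :: "nat \<Rightarrow> (nat \<Rightarrow> real) \<Rightarrow> (real \<Rightarrow> real) \<Rightarrow> nat \<Rightarrow> real" where
  "paverage N X \<phi> i = (ptrace_plus N X \<phi> i + ptrace_minus N X \<phi> i) / 2"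

definition jump :: "(real \<Rightarrow> real) \<Rightarrow> real \<Rightarrow> real" where
  "jump \<phi> y = trace_plus \<phi> y - trace_minus \<phi> y"

definition average :: "(real \<Rightarrow> real) \<Rightarrow> real \<Rightarrow> real" where
  "average \<phi> y = (trace_plus \<phi> y + trace_minus \<phi> y) / 2"

definition flux_x :: "real \<Rightarrow> nat \<Rightarrow> (nat \<Rightarrow> real) \<Rightarrow> (real \<Rightarrow> real \<Rightarrow> real)
    \<Rightarrow> nat \<Rightarrow> real \<Rightarrow> real" where
  "flux_x lam1 Nx X f i v =
     paverage Nx X (\<lambda>x. v * f x v) i
     + (1 - 2 * lam1) / 2 * \<bar>v\<bar> * pjump Nx X (\<lambda>x. f x v) i"

definition flux_v :: "real \<Rightarrow> nat \<Rightarrow> (nat \<Rightarrow> real) \<Rightarrow> (real \<Rightarrow> real) \<Rightarrow> (real \<Rightarrow> real \<Rightarrow> real)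
    \<Rightarrow> real \<Rightarrow> nat \<Rightarrow> real" where
  "flux_v lam2 Nv V u f x j =
     (if j = 0 \<or> j = Nv then 0
      else average (\<lambda>v. (u x - v) * f x v) (V j)
           + (1 - 2 * lam2) / 2 * \<bar>u x - V j\<bar> * jump (\<lambda>v. f x v) (V j))"

definition B_h :: "real \<Rightarrow> real \<Rightarrow> nat \<Rightarrow> (nat \<Rightarrow> real) \<Rightarrow> nat \<Rightarrow> (nat \<Rightarrow> real) \<Rightarrow> nat \<Rightarrow> nat
    \<Rightarrow> (real \<Rightarrow> real) \<Rightarrow> (real \<Rightarrow> real \<Rightarrow> real) \<Rightarrow> (real \<Rightarrow> real \<Rightarrow> real) \<Rightarrow> real" where
  "B_h lam1 lam2 Nx X Nv V i j u f \<psi> =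
     - (LINT (x, v):{X (i - 1)..X i} \<times> {V (j - 1)..V j}|lebesgue.
          v * f x v * deriv (\<lambda>y. \<psi> y v) x)
     - (LINT (x, v):{X (i - 1)..X i} \<times> {V (j - 1)..V j}|lebesgue.
          f x v * (u x - v) * deriv (\<lambda>y. \<psi> x y) v)
     + (LINT v:{V (j - 1)..V j}|lebesgue.
          flux_x lam1 Nx X f i v * ptrace_minus Nx X (\<lambda>x. \<psi> x v) i
          - flux_x lam1 Nx X f (i - 1) v * ptrace_plus Nx X (\<lambda>x. \<psi> x v) (i - 1))
     + (LINT x:{X (i - 1)..X i}|lebesgue.
          flux_v lam2 Nv V u f x j * trace_minus (\<lambda>v. \<psi> x v) (V j)
          - flux_v lam2 Nv V u f x (j - 1) * trace_plus (\<lambda>v. \<psi> x v) (V (j - 1)))"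

definition flux_sq :: "nat \<Rightarrow> (nat \<Rightarrow> real) \<Rightarrow> (real \<Rightarrow> real) \<Rightarrow> nat \<Rightarrow> real" where
  "flux_sq Nx X u i =
     ((ptrace_plus Nx X u i)\<^sup>2 + ptrace_plus Nx X u i * ptrace_minus Nx X u i
      + (ptrace_minus Nx X u i)\<^sup>2) / 3"

definition a_h :: "nat \<Rightarrow> (nat \<Rightarrow> real) \<Rightarrow> (real \<Rightarrow> real) \<Rightarrow> (real \<Rightarrow> real) \<Rightarrow> real" where
  "a_h Nx X u \<phi> =
     - (\<Sum>i=1..Nx. LINT x:{X (i - 1)..X i}|lebesgue. (u x)\<^sup>2 / 2 * deriv \<phi> x)
     - (\<Sum>i<Nx. 1 / 2 * (flux_sq Nx X u i * pjump Nx X \<phi> i))"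

text \<open>The form \<open>b_h\<close> takes the numerical flux of \<open>z\<close> as a separate argument, since the fluxes for
  \<open>z = w\<close> and \<open>z = u\<close> use opposite weights.\<close>

definition b_h :: "nat \<Rightarrow> (nat \<Rightarrow> real) \<Rightarrow> (real \<Rightarrow> real) \<Rightarrow> (nat \<Rightarrow> real) \<Rightarrow> (real \<Rightarrow> real) \<Rightarrow> real" where
  "b_h Nx X z z_hat \<phi> =
     (\<Sum>i=1..Nx. LINT x:{X (i - 1)..X i}|lebesgue. z x * deriv \<phi> x)
     + (\<Sum>i<Nx. z_hat i * pjump Nx X \<phi> i)"

definition flux_w :: "real \<Rightarrow> nat \<Rightarrow> (nat \<Rightarrow> real) \<Rightarrow> (real \<Rightarrow> real) \<Rightarrow> nat \<Rightarrow> real" where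
  "flux_w lam Nx X w i = (1 - lam) * ptrace_minus Nx X w i + lam * ptrace_plus Nx X w i"

definition flux_u :: "real \<Rightarrow> nat \<Rightarrow> (nat \<Rightarrow> real) \<Rightarrow> (real \<Rightarrow> real) \<Rightarrow> nat \<Rightarrow> real" where
  "flux_u lam Nx X u i = lam * ptrace_minus Nx X u i + (1 - lam) * ptrace_plus Nx X u i"

definition rho_h :: "real \<Rightarrow> (real \<Rightarrow> real \<Rightarrow> real) \<Rightarrow> real \<Rightarrow> real" where
  "rho_h M f x = (LINT v:{-M..M}|lebesgue. f x v)"

definition rhoV_h :: "real \<Rightarrow> (real \<Rightarrow> real \<Rightarrow> real) \<Rightarrow> real \<Rightarrow> real" where
  "rhoV_h M f x = (LINT v:{-M..M}|lebesgue. v * f x v)"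

text \<open>
  \<open>S\<close> is the time interval on which the discrete solution is defined; time derivatives are taken
  within \<open>S\<close>, hence are one-sided at its end points.  Differentiability in time at the points of
  the open cells is the same as differentiability of the polynomial coefficients.
\<close>

definition dg_solution :: "nat \<Rightarrow> real \<Rightarrow> real \<Rightarrow> nat \<Rightarrow> (nat \<Rightarrow> real) \<Rightarrow> nat \<Rightarrow> (nat \<Rightarrow> real)
    \<Rightarrow> real \<Rightarrow> real \<Rightarrow> real \<Rightarrow> real \<Rightarrow> real set
    \<Rightarrow> (real \<Rightarrow> real \<Rightarrow> real) \<Rightarrow> (real \<Rightarrow> real \<Rightarrow> real) \<Rightarrow> (real \<Rightarrow> real \<Rightarrow> real \<Rightarrow> real) \<Rightarrow> bool" where
  "dg_solution k L M Nx X Nv V \<epsilon> lam1 lam2 lam S u w f \<longleftrightarrow>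
     (\<forall>t\<in>S. u t \<in> Xh k Nx X \<and> w t \<in> Xh k Nx X \<and> f t \<in> Zh k Nx X Nv V) \<and>
     (\<forall>t\<in>S. \<forall>i\<in>{1..Nx}. \<forall>x\<in>{X (i - 1)<..<X i}.
        (\<lambda>s. u s x) differentiable (at t within S)) \<and>
     (\<forall>t\<in>S. \<forall>i\<in>{1..Nx}. \<forall>j\<in>{1..Nv}. \<forall>x\<in>{X (i - 1)<..<X i}. \<forall>v\<in>{V (j - 1)<..<V j}.
        (\<lambda>s. f s x v) differentiable (at t within S)) \<and>
     (\<forall>t\<in>S. \<forall>\<psi>\<in>Zh k Nx X Nv V.
        inner_\<Omega> L M (\<lambda>x v. vector_derivative (\<lambda>s. f s x v) (at t within S)) \<psi>
        + (\<Sum>i=1..Nx. \<Sum>j=1..Nv. B_h lam1 lam2 Nx X Nv V i j (u t) (f t) \<psi>) = 0) \<and>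
     (\<forall>t\<in>S. \<forall>\<phi>\<in>Xh k Nx X.
        inner_I L (\<lambda>x. vector_derivative (\<lambda>s. u s x) (at t within S)) \<phi>
        + a_h Nx X (u t) \<phi>
        + sqrt \<epsilon> * b_h Nx X (w t) (flux_w lam Nx X (w t)) \<phi>
        + inner_I L (\<lambda>x. rho_h M (f t) x * u t x) \<phi>
        = inner_I L (rhoV_h M (f t)) \<phi>) \<and>
     (\<forall>t\<in>S. \<forall>q\<in>Xh k Nx X.
        inner_I L (w t) q + sqrt \<epsilon> * b_h Nx X (u t) (flux_u lam Nx X (u t)) q = 0)"

end

theory Submission
  imports Defs
begin

text \<open>
  Mass is conserved because the constant function \<open>1\<close> is an admissible test function.  Its
  derivatives vanish and all its traces are \<open>1\<close>, so each cell contribution \<open>B_h\<close> reduces to the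
  net flux through the boundary of the cell (\<open>B_h_const_one\<close>).  The numerical flux is the same
  seen from either side of an edge, so these contributions telescope when they are summed: in \<open>x\<close>
  the two end fluxes coincide by periodicity, in \<open>v\<close> they are zero
  (\<open>sum_B_h_const_one\<close>).  Hence the integral of the time derivative of \<open>f\<^sub>h\<close> is zero.  The initial
  mass is that of \<open>f\<^sub>0\<close> because the defining property of the \<open>L\<^sup>2\<close>-projection may be tested with
  \<open>1\<close> as well.

  Two points need an argument.  To telescope, integrals of differences of fluxes must be split, so
  each flux must be integrable along its edge; for \<open>f\<^sub>h\<close> piecewise polynomial its traces are
  continuous along the open edges (\<open>flux_x_integrable\<close>, \<open>flux_v_integrable\<close>).  And the
  integral over \<open>\<Omega>\<close> has to be differentiated in time although only the values \<open>f\<^sub>h t x v\<close> at single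
  points of the open cells are known to be differentiable, with no uniformity.  Lagrange
  interpolation settles this: on a cell a polynomial is a fixed finite combination of its values at
  nodes inside the cell, hence so is its integral, and differentiation commutes with finite sums
  (\<open>cell_integral_time_derivative\<close>, \<open>mesh_integral_time_derivative\<close>).
\<close>

section \<open>Interpolation of tensor-product polynomials\<close>

definition tensor_poly_on :: "nat \<Rightarrow> real set \<Rightarrow> real set \<Rightarrow> (real \<Rightarrow> real \<Rightarrow> real) \<Rightarrow> bool" where
  "tensor_poly_on k A B g \<longleftrightarrow> (\<exists>c :: nat \<Rightarrow> nat \<Rightarrow> real. \<forall>x\<in>A. \<forall>v\<in>B.
      g x v = (\<Sum>m\<le>k. \<Sum>n\<le>k. c m n * x ^ m * v ^ n))"

lemma Zh_iff:
  "g \<in> Zh k Nx X Nv V \<longleftrightarrow>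
    (\<forall>i\<in>{1..Nx}. \<forall>j\<in>{1..Nv}. tensor_poly_on k {X (i - 1)<..<X i} {V (j - 1)<..<V j} g)"
  by (simp add: Zh_def tensor_poly_on_def)

text \<open>
  The nodes are taken in the open interval, because the functions to be interpolated are
  polynomials there only.  Reproducing the monomials is all that the tensor product needs.
\<close>

lemma lagrange_basis_exists:
  fixes a b :: real
  assumes "a < b"
  obtains P \<phi> where "finite P" "P \<subseteq> {a<..<b}" "\<And>p. continuous_on UNIV (\<phi> p)"
    "\<And>m x. m \<le> k \<Longrightarrow> x ^ m = (\<Sum>p\<in>P. p ^ m * \<phi> p x)"
proof -
  have "infinite {a<..<b}"
    using assms by (simp add: infinite_Ioo)
  then obtain P where P: "finite P" "card P = Suc k" "P \<subseteq> {a<..<b}"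
    using infinite_arbitrarily_large by blast
  define L where "L p = (\<Prod>q\<in>P - {p}. [:- q / (p - q), 1 / (p - q):])" for p
  have deg: "degree (L p) \<le> k" if "p \<in> P" for p
  proof -
    have "degree (L p) \<le> sum (degree \<circ> (\<lambda>q. [:- q / (p - q), 1 / (p - q):])) (P - {p})"
      unfolding L_def using P(1) by (intro degree_prod_sum_le) simp
    also have "\<dots> \<le> (\<Sum>q\<in>P - {p}. 1)"
      by (intro sum_mono) simp
    also have "\<dots> = k"
      using P that by simp
    finally show ?thesis .
  qed
  have nodal: "poly (L p) r = (if r = p then 1 else 0)" if "p \<in> P" "r \<in> P" for p r
  proof (cases "r = p")
    case True
    have "poly (L p) p = (\<Prod>q\<in>P - {p}. 1)"
      unfolding L_def poly_prod
      by (intro prod.cong) (auto simp: divide_simps)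
    then show ?thesis
      using True by simp
  next
    case False
    then have "\<exists>q\<in>P - {p}. poly [:- q / (p - q), 1 / (p - q):] r = 0"
      using that by (intro bexI[of _ r]) auto
    then have "poly (L p) r = 0"
      unfolding L_def poly_prod using P(1) by (intro prod_zero) auto
    then show ?thesis
      using False by simp
  qed
  have "x ^ m = (\<Sum>p\<in>P. p ^ m * poly (L p) x)" if "m \<le> k" for m x
  proof -
    \<comment> \<open>Two polynomials of degree at most \<open>k\<close> that agree at \<open>k + 1\<close> points are equal.\<close>
    have "monom 1 m = (\<Sum>p\<in>P. smult (p ^ m) (L p))"
    proof (rule poly_eqI_degree)
      fix r assume r: "r \<in> P"
      have "(\<Sum>p\<in>P. p ^ m * poly (L p) r) = (\<Sum>p\<in>P. if r = p then p ^ m else 0)"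
        using r by (intro sum.cong) (auto simp: nodal)
      then show "poly (monom 1 m) r = poly (\<Sum>p\<in>P. smult (p ^ m) (L p)) r"
        using P(1) r by (simp add: poly_monom poly_sum)
    next
      show "degree (monom (1::real) m) < card P"
        using that P(2) by (simp add: degree_monom_eq)
      have "degree (\<Sum>p\<in>P. smult (p ^ m) (L p)) \<le> k"
        using P(1) by (intro degree_sum_le) (auto intro: order.trans[OF degree_smult_le] deg)
      then show "degree (\<Sum>p\<in>P. smult (p ^ m) (L p)) < card P"
        using P(2) by simp
    qed
    then have "poly (monom 1 m) x = poly (\<Sum>p\<in>P. smult (p ^ m) (L p)) x"
      by simp
    then show ?thesis
      by (simp add: poly_monom poly_sum)
  qed
  then show ?thesis
    using P by (intro that[of P "\<lambda>p. poly (L p)"]) (auto intro: continuous_intros)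
qed

text \<open>
  The interpolation basis does not depend on \<open>g\<close>, and the coefficients are values of \<open>g\<close>: this
  is what transfers pointwise differentiability in a parameter to the whole function.
\<close>

lemma tensor_poly_interpolation:
  fixes a b c d :: real
  assumes "a < b" "c < d"
  obtains P Q \<phi> \<theta> where "finite P" "P \<subseteq> {a<..<b}" "finite Q" "Q \<subseteq> {c<..<d}"
    "\<And>p. continuous_on UNIV (\<phi> p)" "\<And>q. continuous_on UNIV (\<theta> q)"
    "\<And>g x v. \<lbrakk>tensor_poly_on k {a<..<b} {c<..<d} g; x \<in> {a<..<b}; v \<in> {c<..<d}\<rbrakk> \<Longrightarrow>
      g x v = (\<Sum>p\<in>P. \<Sum>q\<in>Q. g p q * (\<phi> p x * \<theta> q v))"
proof -
  obtain P \<phi> where P: "finite P" "P \<subseteq> {a<..<b}" "\<And>p. continuous_on UNIV (\<phi> p)"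
    "\<And>m x. m \<le> k \<Longrightarrow> x ^ m = (\<Sum>p\<in>P. p ^ m * \<phi> p x)"
    using lagrange_basis_exists[OF \<open>a < b\<close>] by blast
  obtain Q \<theta> where Q: "finite Q" "Q \<subseteq> {c<..<d}" "\<And>q. continuous_on UNIV (\<theta> q)"
    "\<And>n v. n \<le> k \<Longrightarrow> v ^ n = (\<Sum>q\<in>Q. q ^ n * \<theta> q v)"
    using lagrange_basis_exists[OF \<open>c < d\<close>] by blast
  have "g x v = (\<Sum>p\<in>P. \<Sum>q\<in>Q. g p q * (\<phi> p x * \<theta> q v))"
    if g: "tensor_poly_on k {a<..<b} {c<..<d} g" and xv: "x \<in> {a<..<b}" "v \<in> {c<..<d}" for g x v
  proof -
    obtain e where e: "\<And>x v. x \<in> {a<..<b} \<Longrightarrow> v \<in> {c<..<d} \<Longrightarrow>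
        g x v = (\<Sum>m\<le>k. \<Sum>n\<le>k. e m n * x ^ m * v ^ n)"
      using g unfolding tensor_poly_on_def by blast
    have "g x v = (\<Sum>m\<le>k. \<Sum>n\<le>k. e m n * x ^ m * v ^ n)"
      by (rule e[OF xv])
    also have "\<dots> = (\<Sum>m\<le>k. \<Sum>n\<le>k. e m n * (\<Sum>p\<in>P. p ^ m * \<phi> p x) * (\<Sum>q\<in>Q. q ^ n * \<theta> q v))"
      using P(4) Q(4) by (intro sum.cong refl) simp
    also have "\<dots> = (\<Sum>m\<le>k. \<Sum>n\<le>k. \<Sum>p\<in>P. \<Sum>q\<in>Q.
        (e m n * p ^ m * q ^ n) * (\<phi> p x * \<theta> q v))"
      by (simp add: sum_distrib_left sum_distrib_right mult_ac)
    also have "\<dots> = (\<Sum>m\<le>k. \<Sum>p\<in>P. \<Sum>n\<le>k. \<Sum>q\<in>Q.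
        (e m n * p ^ m * q ^ n) * (\<phi> p x * \<theta> q v))"
      by (intro sum.cong refl sum.swap)
    also have "\<dots> = (\<Sum>p\<in>P. \<Sum>m\<le>k. \<Sum>n\<le>k. \<Sum>q\<in>Q.
        (e m n * p ^ m * q ^ n) * (\<phi> p x * \<theta> q v))"
      by (rule sum.swap)
    also have "\<dots> = (\<Sum>p\<in>P. \<Sum>m\<le>k. \<Sum>q\<in>Q. \<Sum>n\<le>k.
        (e m n * p ^ m * q ^ n) * (\<phi> p x * \<theta> q v))"
      by (intro sum.cong refl sum.swap)
    also have "\<dots> = (\<Sum>p\<in>P. \<Sum>q\<in>Q. \<Sum>m\<le>k. \<Sum>n\<le>k.
        (e m n * p ^ m * q ^ n) * (\<phi> p x * \<theta> q v))"
      by (intro sum.cong refl sum.swap)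
    also have "\<dots> = (\<Sum>p\<in>P. \<Sum>q\<in>Q. g p q * (\<phi> p x * \<theta> q v))"
      using P(2) Q(2)
      by (intro sum.cong refl) (simp add: e subset_iff sum_distrib_right)
    finally show ?thesis .
  qed
  then show ?thesis
    using P Q by (intro that[of P Q \<phi> \<theta>]) auto
qed

section \<open>Integration over cells and over the mesh\<close>

lemma open_box_in_sets_lebesgue:
  "{a<..<b} \<times> {c<..<d} \<in> sets (lebesgue :: (real \<times> real) measure)"
  by (intro fmeasurableD lmeasurable_open bounded_Times open_Times) auto

text \<open>
  On an open box, integrability of a function cannot be read off from its continuity alone;
  it has to extend continuously to the closed box, here by agreeing with an everywhere
  continuous function.
\<close>

lemma set_integrable_open_box:
  fixes g h :: "real \<times> real \<Rightarrow> real"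
  assumes h: "continuous_on UNIV h"
    and eq: "\<And>x v. x \<in> {a<..<b} \<Longrightarrow> v \<in> {c<..<d} \<Longrightarrow> g (x, v) = h (x, v)"
  shows "set_integrable lebesgue ({a<..<b} \<times> {c<..<d}) g"
proof -
  have "h absolutely_integrable_on cbox (a, c) (b, d)"
    using h by (intro absolutely_integrable_continuous) (rule continuous_on_subset, auto)
  then have "set_integrable lebesgue ({a<..<b} \<times> {c<..<d}) h"
  proof (rule set_integrable_subset)
    show "{a<..<b} \<times> {c<..<d} \<in> sets lebesgue"
      by (rule open_box_in_sets_lebesgue)
    show "{a<..<b} \<times> {c<..<d} \<subseteq> cbox (a, c) (b, d)"
      by (auto simp: cbox_Pair_eq)
  qed
  moreover have "set_integrable lebesgue ({a<..<b} \<times> {c<..<d}) g \<longleftrightarrow>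
      set_integrable lebesgue ({a<..<b} \<times> {c<..<d}) h"
    by (rule set_integrable_cong) (auto simp: eq)
  ultimately show ?thesis
    by simp
qed

lemma set_integrable_spike_endpoints:
  fixes g h :: "real \<Rightarrow> real"
  assumes h: "continuous_on UNIV h" and eq: "\<And>x. x \<in> {a<..<b} \<Longrightarrow> g x = h x"
  shows "set_integrable lebesgue {a..b} g"
proof (rule absolutely_integrable_spike)
  show "h absolutely_integrable_on {a..b}"
    using h by (intro absolutely_integrable_continuous_real) (rule continuous_on_subset, auto)
  show "negligible {a, b}"
    by simp
  show "g x = h x" if "x \<in> {a..b} - {a, b}" for x
    using that by (intro eq) auto
qed

lemma mesh_node_less:
  assumes "mesh_partition a b N X" "i < j" "j \<le> N"
  shows "X i < X j"
  using assms unfolding mesh_partition_def strict_mono_on_def by auto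

lemma mesh_node_le:
  assumes "mesh_partition a b N X" "i \<le> j" "j \<le> N"
  shows "X i \<le> X j"
  using mesh_node_less[OF assms(1), of i j] assms by (cases "i = j") auto

lemma mesh_cell_subset:
  assumes "mesh_partition a b N X" "i \<in> {1..N}"
  shows "{X (i - 1)<..<X i} \<subseteq> {a..b}"
proof -
  have "X 0 \<le> X (i - 1)" "X i \<le> X N"
    using assms(2) by (auto intro!: mesh_node_le[OF assms(1)])
  then show ?thesis
    using assms(1) by (auto simp: mesh_partition_def)
qed

lemma mesh_cell_unique:
  assumes m: "mesh_partition a b N X" and "i \<in> {1..N}" "i' \<in> {1..N}"
    and "x \<in> {X (i - 1)<..<X i}" "x \<in> {X (i' - 1)<..<X i'}"
  shows "i = i'"
proof -
  have "\<not> i < i'"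
    using mesh_node_le[OF m, of i "i' - 1"] assms by force
  moreover have "\<not> i' < i"
    using mesh_node_le[OF m, of i' "i - 1"] assms by force
  ultimately show ?thesis
    by simp
qed

lemma mesh_cell_exists:
  assumes m: "mesh_partition a b N X" and "x \<in> {a..b}" "x \<notin> X ` {0..N}"
  shows "\<exists>i\<in>{1..N}. x \<in> {X (i - 1)<..<X i}"
proof -
  have N: "X 0 = a" "X N = b"
    using m by (auto simp: mesh_partition_def)
  then have "x < X N"
    using assms by (metis atLeastAtMost_iff image_eqI le0 le_refl less_eq_real_def)
  define i where "i = (LEAST n. x < X n)"
  have i: "x < X i"
    unfolding i_def using \<open>x < X N\<close> by (rule LeastI)
  have "i \<le> N"
    unfolding i_def using \<open>x < X N\<close> by (rule Least_le)
  have "i \<noteq> 0"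
    using i N assms(2) by (auto dest: order.strict_trans2)
  then have "\<not> x < X (i - 1)"
    unfolding i_def by (intro not_less_Least) simp
  moreover have "x \<noteq> X (i - 1)"
    using assms(3) \<open>i \<le> N\<close> by auto
  ultimately show ?thesis
    using i \<open>i \<le> N\<close> \<open>i \<noteq> 0\<close> by (intro bexI[of _ i]) auto
qed

lemma negligible_grid:
  assumes "finite A" "finite B"
  shows "negligible (A \<times> UNIV \<union> UNIV \<times> B :: (real \<times> real) set)"
proof -
  have 1: "negligible ({r} \<times> UNIV :: (real \<times> real) set)" for r
  proof -
    have "{r} \<times> UNIV = {x :: real \<times> real. x \<bullet> (1, 0) = r}"
      by auto
    then show ?thesis
      using negligible_standard_hyperplane[of "(1, 0) :: real \<times> real" r] by (simp add: Basis_prod_def)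
  qed
  have 2: "negligible (UNIV \<times> {r} :: (real \<times> real) set)" for r
  proof -
    have "UNIV \<times> {r} = {x :: real \<times> real. x \<bullet> (0, 1) = r}"
      by auto
    then show ?thesis
      using negligible_standard_hyperplane[of "(0, 1) :: real \<times> real" r] by (simp add: Basis_prod_def)
  qed
  have "A \<times> UNIV = (\<Union>r\<in>A. {r} \<times> (UNIV :: real set))" "UNIV \<times> B = (\<Union>r\<in>B. (UNIV :: real set) \<times> {r})"
    by auto
  moreover have "negligible (\<Union>r\<in>A. {r} \<times> (UNIV :: real set))"
    "negligible (\<Union>r\<in>B. (UNIV :: real set) \<times> {r})"
    using assms 1 2 by (intro negligible_Union; auto)+
  ultimately show ?thesis
    by simp
qed

text \<open>
  The open cells are disjoint and cover the rectangle up to the grid lines, which form a null set.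
\<close>

lemma integral_over_mesh:
  fixes g :: "real \<times> real \<Rightarrow> real"
  assumes mX: "mesh_partition a b Nx X" and mV: "mesh_partition c d Nv V"
    and int: "\<And>i j. i \<in> {1..Nx} \<Longrightarrow> j \<in> {1..Nv} \<Longrightarrow>
      set_integrable lebesgue ({X (i - 1)<..<X i} \<times> {V (j - 1)<..<V j}) g"
  shows "(LINT z:{a..b} \<times> {c..d}|lebesgue. g z)
    = (\<Sum>i=1..Nx. \<Sum>j=1..Nv. LINT z:{X (i - 1)<..<X i} \<times> {V (j - 1)<..<V j}|lebesgue. g z)"
proof -
  define C where "C = (\<lambda>(i, j). {X (i - 1)<..<X i} \<times> {V (j - 1)<..<V j})"
  define I where "I = {1..Nx} \<times> {1..Nv}"
  define U where "U = (\<Union>p\<in>I. C p)"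
  have meas: "C p \<in> sets lebesgue" for p
    unfolding C_def by (cases p) (simp add: open_box_in_sets_lebesgue)
  have intC: "set_integrable lebesgue (C p) g" if "p \<in> I" for p
    using that int by (auto simp: C_def I_def)
  have disj: "disjoint_family_on C I"
    unfolding disjoint_family_on_def
  proof (intro ballI impI)
    fix p q assume pq: "p \<in> I" "q \<in> I" "p \<noteq> q"
    have "p = q" if "z \<in> C p" "z \<in> C q" for z
      using that pq mesh_cell_unique[OF mX, of "fst p" "fst q" "fst z"]
        mesh_cell_unique[OF mV, of "snd p" "snd q" "snd z"]
      by (auto simp: C_def I_def prod_eq_iff split: prod.splits)
    then show "C p \<inter> C q = {}"
      using pq by blast
  qed
  have fin: "finite I"
    by (simp add: I_def)
  have intU: "set_integrable lebesgue U g"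
    unfolding U_def using fin intC meas by (intro set_integrable_UN)
  have "U \<subseteq> {a..b} \<times> {c..d}"
    using mesh_cell_subset[OF mX] mesh_cell_subset[OF mV]
    unfolding U_def C_def I_def by fastforce
  then have 1: "U - {a..b} \<times> {c..d} = {}"
    by blast
  have "{a..b} \<times> {c..d} - U \<subseteq> X ` {0..Nx} \<times> UNIV \<union> UNIV \<times> V ` {0..Nv}"
  proof
    fix z assume z: "z \<in> {a..b} \<times> {c..d} - U"
    show "z \<in> X ` {0..Nx} \<times> UNIV \<union> UNIV \<times> V ` {0..Nv}"
    proof (rule ccontr)
      assume "z \<notin> X ` {0..Nx} \<times> UNIV \<union> UNIV \<times> V ` {0..Nv}"
      then have "fst z \<notin> X ` {0..Nx}" "snd z \<notin> V ` {0..Nv}"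
        by (cases z; auto)+
      then obtain i j where "i \<in> {1..Nx}" "fst z \<in> {X (i - 1)<..<X i}"
        "j \<in> {1..Nv}" "snd z \<in> {V (j - 1)<..<V j}"
        using mesh_cell_exists[OF mX, of "fst z"] mesh_cell_exists[OF mV, of "snd z"] z by auto
      then have "z \<in> U"
        unfolding U_def C_def I_def by (intro UN_I[of "(i, j)"]) (auto simp: mem_Times_iff)
      then show False
        using z by simp
    qed
  qed
  then have 2: "negligible ({a..b} \<times> {c..d} - U)"
    using negligible_grid by (rule negligible_subset[rotated]) auto
  have "g absolutely_integrable_on {a..b} \<times> {c..d} \<longleftrightarrow> g absolutely_integrable_on U"
    by (rule absolutely_integrable_spike_set_eq) (auto intro: negligible_subset[OF 2] simp: 1)
  then have "(LINT z:{a..b} \<times> {c..d}|lebesgue. g z) = integral ({a..b} \<times> {c..d}) g"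
    using intU by (intro set_lebesgue_integral_eq_integral) simp
  also have "\<dots> = integral U g"
    by (rule integral_spike_set) (auto intro: negligible_subset[OF 2] simp: 1)
  also have "\<dots> = (LINT z:U|lebesgue. g z)"
    using intU by (rule set_lebesgue_integral_eq_integral(2)[symmetric])
  also have "\<dots> = (\<Sum>p\<in>I. LINT z:C p|lebesgue. g z)"
    unfolding U_def using fin disj intC meas by (rule set_integral_finite_Union)
  also have "\<dots> = (\<Sum>i=1..Nx. \<Sum>j=1..Nv. LINT z:C (i, j)|lebesgue. g z)"
    unfolding I_def by (simp add: sum.cartesian_product)
  finally show ?thesis
    by (simp add: C_def)
qed

section \<open>Differentiation of cell integrals in time\<close>

text \<open>
  Let \<open>g s x v = (\<Sum>p\<in>P. \<Sum>q\<in>Q. g s p q * (\<phi> p x * \<theta> q v))\<close> be the interpolation formula of the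
  cell.  Only the nodal values depend on \<open>s\<close>, so the time derivative satisfies the same formula
  (which makes it integrable), and integrating both formulas with the fixed weights
  \<open>\<integral> \<phi> p x * \<theta> q v\<close> shows that the integral of the derivative is the derivative of the integral.
  That \<open>t\<close> is not isolated in \<open>S\<close> makes derivatives within \<open>S\<close> unique.
\<close>

lemma cell_integral_time_derivative:
  fixes g :: "real \<Rightarrow> real \<Rightarrow> real \<Rightarrow> real"
  assumes ab: "a < b" and cd: "c < d" and t: "t \<in> S" "at t within S \<noteq> bot"
    and poly: "\<And>s. s \<in> S \<Longrightarrow> tensor_poly_on k {a<..<b} {c<..<d} (g s)"
    and diff: "\<And>x v. x \<in> {a<..<b} \<Longrightarrow> v \<in> {c<..<d} \<Longrightarrow>
      (\<lambda>s. g s x v) differentiable (at t within S)"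
  defines "D \<equiv> \<lambda>x v. vector_derivative (\<lambda>s. g s x v) (at t within S)"
  shows "set_integrable lebesgue ({a<..<b} \<times> {c<..<d}) (\<lambda>(x, v). D x v)"
    and "((\<lambda>s. LINT (x, v):{a<..<b} \<times> {c<..<d}|lebesgue. g s x v) has_real_derivative
          (LINT (x, v):{a<..<b} \<times> {c<..<d}|lebesgue. D x v)) (at t within S)"
proof -
  define C where "C = {a<..<b} \<times> {c<..<d}"
  obtain P Q \<phi> \<theta> where PQ: "finite P" "P \<subseteq> {a<..<b}" "finite Q" "Q \<subseteq> {c<..<d}"
    and cont: "\<And>p. continuous_on UNIV (\<phi> p)" "\<And>q. continuous_on UNIV (\<theta> q)"
    and interp: "\<And>g x v. \<lbrakk>tensor_poly_on k {a<..<b} {c<..<d} g; x \<in> {a<..<b}; v \<in> {c<..<d}\<rbrakk> \<Longrightarrow>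
      g x v = (\<Sum>p\<in>P. \<Sum>q\<in>Q. g p q * (\<phi> p x * \<theta> q v))"
    by (rule tensor_poly_interpolation[OF ab cd, of k]) (rule that)
  have deriv: "((\<lambda>s. g s x v) has_real_derivative D x v) (at t within S)"
    if "x \<in> {a<..<b}" "v \<in> {c<..<d}" for x v
    using diff[OF that] unfolding D_def
    by (simp add: vector_derivative_works has_real_derivative_iff_has_vector_derivative)
  have interpg: "g s x v = (\<Sum>p\<in>P. \<Sum>q\<in>Q. g s p q * (\<phi> p x * \<theta> q v))"
    if "s \<in> S" "x \<in> {a<..<b}" "v \<in> {c<..<d}" for s x v
    using that by (intro interp poly)
  have interpD: "D x v = (\<Sum>p\<in>P. \<Sum>q\<in>Q. D p q * (\<phi> p x * \<theta> q v))"
    if xv: "x \<in> {a<..<b}" "v \<in> {c<..<d}" for x v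
  proof -
    have "((\<lambda>s. \<Sum>p\<in>P. \<Sum>q\<in>Q. g s p q * (\<phi> p x * \<theta> q v)) has_real_derivative
        (\<Sum>p\<in>P. \<Sum>q\<in>Q. D p q * (\<phi> p x * \<theta> q v))) (at t within S)"
      using PQ by (intro DERIV_sum DERIV_cmult_right deriv) auto
    then have "((\<lambda>s. g s x v) has_vector_derivative
        (\<Sum>p\<in>P. \<Sum>q\<in>Q. D p q * (\<phi> p x * \<theta> q v))) (at t within S)"
      unfolding has_real_derivative_iff_has_vector_derivative
      by (rule has_vector_derivative_transform[OF t(1), rotated]) (rule interpg[OF _ xv])
    then show ?thesis
      unfolding D_def by (rule vector_derivative_within[OF t(2)])
  qed
  have intW: "set_integrable lebesgue C (\<lambda>(x, v). \<phi> p x * \<theta> q v)" for p q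
    unfolding C_def
    by (rule set_integrable_open_box[where h = "\<lambda>z. \<phi> p (fst z) * \<theta> q (snd z)"])
      (auto intro!: continuous_intros continuous_on_compose2[OF cont(1)] continuous_on_compose2[OF cont(2)])
  define W where "W p q = (LINT (x, v):C|lebesgue. \<phi> p x * \<theta> q v)" for p q
  have int_sum: "set_integrable lebesgue C (\<lambda>(x, v). G x v)"
    "(LINT (x, v):C|lebesgue. G x v) = (\<Sum>p\<in>P. \<Sum>q\<in>Q. G p q * W p q)"
    if G: "\<And>x v. x \<in> {a<..<b} \<Longrightarrow> v \<in> {c<..<d} \<Longrightarrow>
      G x v = (\<Sum>p\<in>P. \<Sum>q\<in>Q. G p q * (\<phi> p x * \<theta> q v))" for G
  proof -
    define H where "H p q = (\<lambda>z. G p q * (\<lambda>(x, v). \<phi> p x * \<theta> q v) z)" for p q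
    have "set_integrable lebesgue C (H p q)" for p q
      unfolding H_def by (intro set_integrable_mult_right intW)
    then have intH: "integrable lebesgue (\<lambda>z. indicator C z *\<^sub>R H p q z)" for p q
      by (simp add: set_integrable_def)
    have eq: "(\<lambda>z. indicator C z *\<^sub>R (\<lambda>(x, v). G x v) z)
        = (\<lambda>z. \<Sum>p\<in>P. \<Sum>q\<in>Q. indicator C z *\<^sub>R H p q z)"
    proof
      fix z :: "real \<times> real"
      show "indicator C z *\<^sub>R (\<lambda>(x, v). G x v) z = (\<Sum>p\<in>P. \<Sum>q\<in>Q. indicator C z *\<^sub>R H p q z)"
      proof (cases "z \<in> C")
        case True
        then show ?thesis
          using G[of "fst z" "snd z"] by (auto simp: C_def H_def)
      next
        case False
        then show ?thesis
          by simp
      qed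
    qed
    show "set_integrable lebesgue C (\<lambda>(x, v). G x v)"
      unfolding set_integrable_def eq using intH by (intro Bochner_Integration.integrable_sum)
    have "(LINT (x, v):C|lebesgue. G x v)
        = (\<Sum>p\<in>P. \<Sum>q\<in>Q. integral\<^sup>L lebesgue (\<lambda>z. indicator C z *\<^sub>R H p q z))"
      unfolding set_lebesgue_integral_def eq using intH by simp
    also have "\<dots> = (\<Sum>p\<in>P. \<Sum>q\<in>Q. G p q * W p q)"
    proof (intro sum.cong refl)
      fix p q
      have "(LINT z:C|lebesgue. H p q z) = G p q * W p q"
        unfolding H_def W_def by (rule set_integral_mult_right)
      then show "integral\<^sup>L lebesgue (\<lambda>z. indicator C z *\<^sub>R H p q z) = G p q * W p q"
        by (simp add: set_lebesgue_integral_def)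
    qed
    finally show "(LINT (x, v):C|lebesgue. G x v) = (\<Sum>p\<in>P. \<Sum>q\<in>Q. G p q * W p q)" .
  qed
  show "set_integrable lebesgue ({a<..<b} \<times> {c<..<d}) (\<lambda>(x, v). D x v)"
    using int_sum(1)[OF interpD] unfolding C_def by simp
  have "((\<lambda>s. \<Sum>p\<in>P. \<Sum>q\<in>Q. g s p q * W p q) has_real_derivative
      (\<Sum>p\<in>P. \<Sum>q\<in>Q. D p q * W p q)) (at t within S)"
    using PQ by (intro DERIV_sum DERIV_cmult_right deriv) auto
  then have "((\<lambda>s. LINT (x, v):C|lebesgue. g s x v) has_real_derivative
      (\<Sum>p\<in>P. \<Sum>q\<in>Q. D p q * W p q)) (at t within S)"
    unfolding has_real_derivative_iff_has_vector_derivative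
    by (rule has_vector_derivative_transform[OF t(1), rotated])
      (intro int_sum(2) interpg)
  then show "((\<lambda>s. LINT (x, v):{a<..<b} \<times> {c<..<d}|lebesgue. g s x v) has_real_derivative
          (LINT (x, v):{a<..<b} \<times> {c<..<d}|lebesgue. D x v)) (at t within S)"
    using int_sum(2)[OF interpD] unfolding C_def by simp
qed

lemma set_integrable_tensor_poly:
  assumes "tensor_poly_on k {a<..<b} {c<..<d} g"
  shows "set_integrable lebesgue ({a<..<b} \<times> {c<..<d}) (\<lambda>(x, v). g x v)"
proof -
  obtain e where "\<And>x v. x \<in> {a<..<b} \<Longrightarrow> v \<in> {c<..<d} \<Longrightarrow>
      g x v = (\<Sum>m\<le>k. \<Sum>n\<le>k. e m n * x ^ m * v ^ n)"
    using assms unfolding tensor_poly_on_def by blast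
  then show ?thesis
    by (intro set_integrable_open_box[where h = "\<lambda>z. \<Sum>m\<le>k. \<Sum>n\<le>k. e m n * fst z ^ m * snd z ^ n"])
      (auto intro!: continuous_intros)
qed

lemma mesh_integral_time_derivative:
  assumes mX: "mesh_partition a b Nx X" and mV: "mesh_partition c d Nv V"
    and t: "t \<in> S" "at t within S \<noteq> bot"
    and Zh: "\<And>s. s \<in> S \<Longrightarrow> f s \<in> Zh k Nx X Nv V"
    and diff: "\<And>i j x v. \<lbrakk>i \<in> {1..Nx}; j \<in> {1..Nv}; x \<in> {X (i - 1)<..<X i};
      v \<in> {V (j - 1)<..<V j}\<rbrakk> \<Longrightarrow> (\<lambda>s. f s x v) differentiable (at t within S)"
  shows "((\<lambda>s. LINT (x, v):{a..b} \<times> {c..d}|lebesgue. f s x v) has_real_derivative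
    (LINT (x, v):{a..b} \<times> {c..d}|lebesgue. vector_derivative (\<lambda>s. f s x v) (at t within S)))
    (at t within S)"
proof -
  let ?C = "\<lambda>i j. {X (i - 1)<..<X i} \<times> {V (j - 1)<..<V j}"
  have less: "X (i - 1) < X i" "V (j - 1) < V j" if "i \<in> {1..Nx}" "j \<in> {1..Nv}" for i j
    using that by (auto intro!: mesh_node_less[OF mX] mesh_node_less[OF mV])
  note cell = cell_integral_time_derivative[OF less t, where g = f and k = k]
  have "((\<lambda>s. \<Sum>i=1..Nx. \<Sum>j=1..Nv. LINT (x, v):?C i j|lebesgue. f s x v) has_real_derivative
    (\<Sum>i=1..Nx. \<Sum>j=1..Nv. LINT (x, v):?C i j|lebesgue.
      vector_derivative (\<lambda>s. f s x v) (at t within S))) (at t within S)"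
    using Zh diff by (intro DERIV_sum cell(2)) (auto simp: Zh_iff)
  also have "(\<Sum>i=1..Nx. \<Sum>j=1..Nv. LINT (x, v):?C i j|lebesgue.
      vector_derivative (\<lambda>s. f s x v) (at t within S))
    = (LINT (x, v):{a..b} \<times> {c..d}|lebesgue. vector_derivative (\<lambda>s. f s x v) (at t within S))"
    using Zh diff
    by (intro integral_over_mesh[OF mX mV, symmetric] cell(1)) (auto simp: Zh_iff)
  finally have deriv: "((\<lambda>s. \<Sum>i=1..Nx. \<Sum>j=1..Nv. LINT (x, v):?C i j|lebesgue. f s x v)
    has_real_derivative
    (LINT (x, v):{a..b} \<times> {c..d}|lebesgue. vector_derivative (\<lambda>s. f s x v) (at t within S)))
    (at t within S)" .
  have "(LINT (x, v):{a..b} \<times> {c..d}|lebesgue. f s x v)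
      = (\<Sum>i=1..Nx. \<Sum>j=1..Nv. LINT (x, v):?C i j|lebesgue. f s x v)" if "s \<in> S" for s
  proof (rule integral_over_mesh[OF mX mV])
    fix i j assume "i \<in> {1..Nx}" "j \<in> {1..Nv}"
    then have "tensor_poly_on k {X (i - 1)<..<X i} {V (j - 1)<..<V j} (f s)"
      using Zh[OF that] unfolding Zh_iff by blast
    then show "set_integrable lebesgue (?C i j) (\<lambda>(x, v). f s x v)"
      by (rule set_integrable_tensor_poly)
  qed
  then show ?thesis
    using deriv unfolding has_real_derivative_iff_has_vector_derivative
    by (rule has_vector_derivative_transform[OF t(1)])
qed

section \<open>Traces and numerical fluxes\<close>

text \<open>
  Exchanging the roles of \<open>x\<close> and \<open>v\<close> reduces statements about traces in \<open>v\<close> to those in \<open>x\<close>.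
\<close>

lemma tensor_poly_on_swap:
  assumes "tensor_poly_on k A B g"
  shows "tensor_poly_on k B A (\<lambda>v x. g x v)"
proof -
  obtain e where e: "\<And>x v. x \<in> A \<Longrightarrow> v \<in> B \<Longrightarrow> g x v = (\<Sum>m\<le>k. \<Sum>n\<le>k. e m n * x ^ m * v ^ n)"
    using assms unfolding tensor_poly_on_def by blast
  have "g x v = (\<Sum>n\<le>k. \<Sum>m\<le>k. e m n * v ^ n * x ^ m)" if "x \<in> A" "v \<in> B" for x v
    using e[OF that] by (subst sum.swap) (simp add: mult_ac)
  then show ?thesis
    unfolding tensor_poly_on_def by (intro exI[of _ "\<lambda>n m. e m n"]) auto
qed

lemma Zh_swap:
  assumes "g \<in> Zh k Nx X Nv V"
  shows "(\<lambda>v x. g x v) \<in> Zh k Nv V Nx X"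
  unfolding Zh_iff
proof (intro ballI)
  fix j i assume "j \<in> {1..Nv}" "i \<in> {1..Nx}"
  then have "tensor_poly_on k {X (i - 1)<..<X i} {V (j - 1)<..<V j} g"
    using assms unfolding Zh_iff by blast
  then show "tensor_poly_on k {V (j - 1)<..<V j} {X (i - 1)<..<X i} (\<lambda>v x. g x v)"
    by (rule tensor_poly_on_swap)
qed

text \<open>
  The traces are given by functions that are continuous on the whole line, including the end points
  of the edge, where \<open>g\<close> itself is unconstrained.
\<close>

lemma tensor_poly_on_one_sided_limits:
  fixes a b :: real
  assumes "a < b" "tensor_poly_on k {a<..<b} B g"
  obtains r s where "continuous_on UNIV r" "\<And>v. v \<in> B \<Longrightarrow> ((\<lambda>x. g x v) \<longlongrightarrow> r v) (at_right a)"
    "continuous_on UNIV s" "\<And>v. v \<in> B \<Longrightarrow> ((\<lambda>x. g x v) \<longlongrightarrow> s v) (at_left b)"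
proof -
  obtain e where e: "\<And>x v. x \<in> {a<..<b} \<Longrightarrow> v \<in> B \<Longrightarrow>
      g x v = (\<Sum>m\<le>k. \<Sum>n\<le>k. e m n * x ^ m * v ^ n)"
    using assms unfolding tensor_poly_on_def by blast
  let ?h = "\<lambda>x v. \<Sum>m\<le>k. \<Sum>n\<le>k. e m n * x ^ m * v ^ n"
  have lim: "((\<lambda>x. ?h x v) \<longlongrightarrow> ?h y v) (at y within T)" for y v T
    by (intro tendsto_intros)
  show ?thesis
  proof
    show "continuous_on UNIV (?h a)" "continuous_on UNIV (?h b)"
      by (auto intro!: continuous_intros)
    fix v assume v: "v \<in> B"
    have "eventually (\<lambda>x. ?h x v = g x v) (at_right a)"
      unfolding eventually_at_right[OF \<open>a < b\<close>] using e v \<open>a < b\<close> by (intro exI[of _ b]) auto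
    then show "((\<lambda>x. g x v) \<longlongrightarrow> ?h a v) (at_right a)"
      using lim by (rule Lim_transform_eventually[rotated])
    have "eventually (\<lambda>x. ?h x v = g x v) (at_left b)"
      unfolding eventually_at_left[OF \<open>a < b\<close>] using e v \<open>a < b\<close> by (intro exI[of _ a]) auto
    then show "((\<lambda>x. g x v) \<longlongrightarrow> ?h b v) (at_left b)"
      using lim by (rule Lim_transform_eventually[rotated])
  qed
qed

lemma Zh_limit_right:
  assumes "mesh_partition a b Nx X" "g \<in> Zh k Nx X Nv V" "i < Nx" "j \<in> {1..Nv}"
  obtains r where "continuous_on UNIV r"
    "\<And>v. v \<in> {V (j - 1)<..<V j} \<Longrightarrow> ((\<lambda>x. g x v) \<longlongrightarrow> r v) (at_right (X i))"
proof -
  have "X i < X (Suc i)"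
    using assms(3) by (intro mesh_node_less[OF assms(1)]) auto
  moreover have "tensor_poly_on k {X i<..<X (Suc i)} {V (j - 1)<..<V j} g"
  proof -
    have "Suc i \<in> {1..Nx}"
      using assms(3) by simp
    then show ?thesis
      using assms(2,4) unfolding Zh_iff by fastforce
  qed
  ultimately show ?thesis
    using tensor_poly_on_one_sided_limits that by metis
qed

lemma Zh_limit_left:
  assumes "mesh_partition a b Nx X" "g \<in> Zh k Nx X Nv V" "i \<in> {1..Nx}" "j \<in> {1..Nv}"
  obtains r where "continuous_on UNIV r"
    "\<And>v. v \<in> {V (j - 1)<..<V j} \<Longrightarrow> ((\<lambda>x. g x v) \<longlongrightarrow> r v) (at_left (X i))"
proof -
  have "X (i - 1) < X i"
    using assms(3) by (intro mesh_node_less[OF assms(1)]) auto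
  moreover have "tensor_poly_on k {X (i - 1)<..<X i} {V (j - 1)<..<V j} g"
    using assms(2-4) unfolding Zh_iff by blast
  ultimately show ?thesis
    using tensor_poly_on_one_sided_limits that by metis
qed

lemma trace_plus_eqI: "(\<phi> \<longlongrightarrow> l) (at_right y) \<Longrightarrow> trace_plus \<phi> y = l"
  unfolding trace_plus_def by (intro tendsto_Lim) auto

lemma trace_minus_eqI: "(\<phi> \<longlongrightarrow> l) (at_left y) \<Longrightarrow> trace_minus \<phi> y = l"
  unfolding trace_minus_def by (intro tendsto_Lim) auto

text \<open>
  The flux agrees on the open edge with a continuous function built from the two traces.
\<close>

lemma flux_x_integrable:
  assumes mX: "mesh_partition a b Nx X" and f: "f \<in> Zh k Nx X Nv V"
    and i: "i \<le> Nx" and j: "j \<in> {1..Nv}"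
  shows "set_integrable lebesgue {V (j - 1)..V j} (flux_x lam1 Nx X f i)"
proof -
  \<comment> \<open>The left trace is taken at the node \<open>l\<close>, the right trace at \<open>r\<close>; these differ only at the identified ends.\<close>
  define l r where "l = (if i = 0 then Nx else i)" and "r = (if i = Nx then 0 else i)"
  have "1 \<le> Nx"
    using mX by (simp add: mesh_partition_def)
  then have "l \<in> {1..Nx}" "r < Nx"
    using i by (auto simp: l_def r_def)
  obtain R where R: "continuous_on UNIV R"
    "\<And>v. v \<in> {V (j - 1)<..<V j} \<Longrightarrow> ((\<lambda>x. f x v) \<longlongrightarrow> R v) (at_right (X r))"
    using Zh_limit_right[OF mX f \<open>r < Nx\<close> j] by blast
  obtain L where L: "continuous_on UNIV L"
    "\<And>v. v \<in> {V (j - 1)<..<V j} \<Longrightarrow> ((\<lambda>x. f x v) \<longlongrightarrow> L v) (at_left (X l))"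
    using Zh_limit_left[OF mX f \<open>l \<in> {1..Nx}\<close> j] by blast
  have traces: "ptrace_plus Nx X \<phi> i = trace_plus \<phi> (X r)" "ptrace_minus Nx X \<phi> i = trace_minus \<phi> (X l)" for \<phi>
    by (auto simp: ptrace_plus_def ptrace_minus_def l_def r_def)
  show ?thesis
  proof (rule set_integrable_spike_endpoints)
    show "continuous_on UNIV
        (\<lambda>v. (v * R v + v * L v) / 2 + (1 - 2 * lam1) / 2 * \<bar>v\<bar> * (R v - L v))"
      using R(1) L(1) by (auto intro!: continuous_intros)
    fix v assume v: "v \<in> {V (j - 1)<..<V j}"
    have "trace_plus (\<lambda>x. v * f x v) (X r) = v * R v" "trace_plus (\<lambda>x. f x v) (X r) = R v"
      using R(2)[OF v] by (auto intro!: trace_plus_eqI tendsto_intros)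
    moreover have "trace_minus (\<lambda>x. v * f x v) (X l) = v * L v" "trace_minus (\<lambda>x. f x v) (X l) = L v"
      using L(2)[OF v] by (auto intro!: trace_minus_eqI tendsto_intros)
    ultimately show "flux_x lam1 Nx X f i v
        = (v * R v + v * L v) / 2 + (1 - 2 * lam1) / 2 * \<bar>v\<bar> * (R v - L v)"
      by (simp add: flux_x_def paverage_def pjump_def traces)
  qed
qed

lemma flux_v_integrable:
  assumes mV: "mesh_partition c d Nv V" and f: "f \<in> Zh k Nx X Nv V" and u: "u \<in> Xh k Nx X"
    and i: "i \<in> {1..Nx}" and j: "j \<le> Nv"
  shows "set_integrable lebesgue {X (i - 1)..X i} (\<lambda>x. flux_v lam2 Nv V u f x j)"
proof (cases "j = 0 \<or> j = Nv")
  case True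
  then show ?thesis
    by (auto simp: flux_v_def set_integrable_def)
next
  case False
  then have "j \<in> {1..Nv}" "j < Nv"
    using j by auto
  obtain R where R: "continuous_on UNIV R"
    "\<And>x. x \<in> {X (i - 1)<..<X i} \<Longrightarrow> ((\<lambda>v. f x v) \<longlongrightarrow> R x) (at_right (V j))"
    using Zh_limit_right[OF mV Zh_swap[OF f] \<open>j < Nv\<close> i] by blast
  obtain L where L: "continuous_on UNIV L"
    "\<And>x. x \<in> {X (i - 1)<..<X i} \<Longrightarrow> ((\<lambda>v. f x v) \<longlongrightarrow> L x) (at_left (V j))"
    using Zh_limit_left[OF mV Zh_swap[OF f] \<open>j \<in> {1..Nv}\<close> i] by blast
  obtain p where p: "\<And>x. x \<in> {X (i - 1)<..<X i} \<Longrightarrow> u x = poly p x"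
    using u i unfolding Xh_def by blast
  show ?thesis
  proof (rule set_integrable_spike_endpoints)
    show "continuous_on UNIV (\<lambda>x. ((poly p x - V j) * R x + (poly p x - V j) * L x) / 2
        + (1 - 2 * lam2) / 2 * \<bar>poly p x - V j\<bar> * (R x - L x))"
      using R(1) L(1) by (auto intro!: continuous_intros)
    fix x assume x: "x \<in> {X (i - 1)<..<X i}"
    have "trace_plus (\<lambda>v. (u x - v) * f x v) (V j) = (u x - V j) * R x"
      "trace_plus (\<lambda>v. f x v) (V j) = R x"
      using R(2)[OF x] by (auto intro!: trace_plus_eqI tendsto_intros)
    moreover have "trace_minus (\<lambda>v. (u x - v) * f x v) (V j) = (u x - V j) * L x"
      "trace_minus (\<lambda>v. f x v) (V j) = L x"
      using L(2)[OF x] by (auto intro!: trace_minus_eqI tendsto_intros)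
    ultimately show "flux_v lam2 Nv V u f x j
        = ((poly p x - V j) * R x + (poly p x - V j) * L x) / 2
          + (1 - 2 * lam2) / 2 * \<bar>poly p x - V j\<bar> * (R x - L x)"
      using False p[OF x] by (simp add: flux_v_def average_def jump_def)
  qed
qed

section \<open>Telescoping of the fluxes and conservation of mass\<close>

lemma sum_flux_differences_eq_0:
  fixes G :: "nat \<Rightarrow> real \<Rightarrow> real"
  assumes "\<And>i. i \<le> N \<Longrightarrow> set_integrable M A (G i)" and "G N = G 0"
  shows "(\<Sum>i=1..N. LINT y:A|M. G i y - G (i - 1) y) = 0"
proof -
  have "(\<Sum>i=1..N. LINT y:A|M. G i y - G (i - 1) y)
      = (\<Sum>i=Suc 0..N. (LINT y:A|M. G i y) - (LINT y:A|M. G (i - 1) y))"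
    using assms(1) by (intro sum.cong set_integral_diff) auto
  also have "\<dots> = (LINT y:A|M. G N y) - (LINT y:A|M. G 0 y)"
    by (rule sum_telescope'') simp
  finally show ?thesis
    using assms(2) by simp
qed

text \<open>
  Tested with the constant \<open>1\<close>, the volume terms disappear and the net flux through the boundary
  of the cell remains.
\<close>

lemma B_h_const_one:
  "B_h lam1 lam2 Nx X Nv V i j u f (\<lambda>x v. 1) =
    (LINT v:{V (j - 1)..V j}|lebesgue. flux_x lam1 Nx X f i v - flux_x lam1 Nx X f (i - 1) v)
    + (LINT x:{X (i - 1)..X i}|lebesgue. flux_v lam2 Nv V u f x j - flux_v lam2 Nv V u f x (j - 1))"
proof -
  have "trace_plus (\<lambda>x. 1) y = 1" "trace_minus (\<lambda>x. 1) y = 1" for y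
    by (auto intro: trace_plus_eqI trace_minus_eqI)
  then show ?thesis
    by (simp add: B_h_def ptrace_plus_def ptrace_minus_def case_prod_unfold)
qed

text \<open>
  For fixed \<open>j\<close> the fluxes in \<open>x\<close> telescope around the periodic direction; for fixed \<open>i\<close> the
  fluxes in \<open>v\<close> telescope to the prescribed zero fluxes at the two ends of the velocity interval.
\<close>

lemma sum_B_h_const_one:
  assumes mX: "mesh_partition a b Nx X" and mV: "mesh_partition c d Nv V"
    and f: "f \<in> Zh k Nx X Nv V" and u: "u \<in> Xh k Nx X"
  shows "(\<Sum>i=1..Nx. \<Sum>j=1..Nv. B_h lam1 lam2 Nx X Nv V i j u f (\<lambda>x v. 1)) = 0"
proof -
  have Nx: "1 \<le> Nx"
    using mX by (simp add: mesh_partition_def)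
  have x: "(\<Sum>i=1..Nx. LINT v:{V (j - 1)..V j}|lebesgue.
      flux_x lam1 Nx X f i v - flux_x lam1 Nx X f (i - 1) v) = 0" if "j \<in> {1..Nv}" for j
  proof (rule sum_flux_differences_eq_0)
    show "set_integrable lebesgue {V (j - 1)..V j} (flux_x lam1 Nx X f i)" if "i \<le> Nx" for i
      using flux_x_integrable[OF mX f that \<open>j \<in> {1..Nv}\<close>] .
    show "flux_x lam1 Nx X f Nx = flux_x lam1 Nx X f 0"
      using Nx by (auto simp: flux_x_def paverage_def pjump_def ptrace_plus_def ptrace_minus_def)
  qed
  have v: "(\<Sum>j=1..Nv. LINT x:{X (i - 1)..X i}|lebesgue.
      flux_v lam2 Nv V u f x j - flux_v lam2 Nv V u f x (j - 1)) = 0" if "i \<in> {1..Nx}" for i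
  proof (rule sum_flux_differences_eq_0)
    show "set_integrable lebesgue {X (i - 1)..X i} (\<lambda>x. flux_v lam2 Nv V u f x j)" if "j \<le> Nv" for j
      using flux_v_integrable[OF mV f u \<open>i \<in> {1..Nx}\<close> that] .
    show "(\<lambda>x. flux_v lam2 Nv V u f x Nv) = (\<lambda>x. flux_v lam2 Nv V u f x 0)"
      by (simp add: flux_v_def)
  qed
  have "(\<Sum>i=1..Nx. \<Sum>j=1..Nv. B_h lam1 lam2 Nx X Nv V i j u f (\<lambda>x v. 1))
      = (\<Sum>i=1..Nx. \<Sum>j=1..Nv. LINT v:{V (j - 1)..V j}|lebesgue.
          flux_x lam1 Nx X f i v - flux_x lam1 Nx X f (i - 1) v)
        + (\<Sum>i=1..Nx. \<Sum>j=1..Nv. LINT x:{X (i - 1)..X i}|lebesgue.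
          flux_v lam2 Nv V u f x j - flux_v lam2 Nv V u f x (j - 1))"
    by (simp add: B_h_const_one sum.distrib)
  also have "(\<Sum>i=1..Nx. \<Sum>j=1..Nv. LINT v:{V (j - 1)..V j}|lebesgue.
      flux_x lam1 Nx X f i v - flux_x lam1 Nx X f (i - 1) v) = 0"
    by (subst sum.swap, intro sum.neutral ballI x)
  also have "(\<Sum>i=1..Nx. \<Sum>j=1..Nv. LINT x:{X (i - 1)..X i}|lebesgue.
      flux_v lam2 Nv V u f x j - flux_v lam2 Nv V u f x (j - 1)) = 0"
    by (intro sum.neutral ballI v)
  finally show ?thesis
    by simp
qed

lemma const_one_in_Zh: "(\<lambda>x v. 1) \<in> Zh k Nx X Nv V"
proof -
  \<comment> \<open>As \<open>0 ^ 0 = 1\<close>, the coefficient \<open>0 ^ m * 0 ^ n\<close> selects the constant monomial.\<close>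
  have "(\<Sum>m\<le>k. \<Sum>n\<le>k. 0 ^ m * 0 ^ n * x ^ m * v ^ n) = 1" for x v :: real
  proof -
    have "(\<Sum>m\<le>k. \<Sum>n\<le>k. 0 ^ m * 0 ^ n * x ^ m * v ^ n)
        = (\<Sum>m\<le>k. (0 * x) ^ m) * (\<Sum>n\<le>k. (0 * v) ^ n)"
      unfolding sum_product by (intro sum.cong refl) (auto simp: power_0_left)
    also have "\<dots> = 1"
      by (simp add: power_0_left)
    finally show ?thesis .
  qed
  then show ?thesis
    unfolding Zh_iff tensor_poly_on_def by (intro ballI exI[of _ "\<lambda>m n. 0 ^ m * 0 ^ n"]) simp
qed

theorem lemma3p3:
  fixes k Nx Nv :: nat
    and L M \<epsilon> lam1 lam2 lam :: real
    and X V :: "nat \<Rightarrow> real"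
    and f\<^sub>0 :: "real \<Rightarrow> real \<Rightarrow> real"
    and S :: "real set"
    and u\<^sub>h w\<^sub>h :: "real \<Rightarrow> real \<Rightarrow> real"
    and f\<^sub>h :: "real \<Rightarrow> real \<Rightarrow> real \<Rightarrow> real"
  assumes "0 < L" and "0 < M" and "0 < \<epsilon>"
    and "1 / 2 < lam1" and "1 / 2 < lam2" and "1 / 2 \<le> lam"
    and "mesh_partition 0 L Nx X" and "mesh_partition (- M) M Nv V"
    and "square_integrable_\<Omega> L M f\<^sub>0"
    and "closure {(x, v). x \<in> {0..L} \<and> f\<^sub>0 x v \<noteq> 0} \<subseteq> {0..L} \<times> {-M..M}"
    and "is_interval S" and "0 \<in> S" and "S \<subseteq> {0..}"
    and "dg_solution k L M Nx X Nv V \<epsilon> lam1 lam2 lam S u\<^sub>h w\<^sub>h f\<^sub>h"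
    and "is_L2_projection k L M Nx X Nv V f\<^sub>0 (f\<^sub>h 0)"
  shows "\<forall>t\<in>S. 0 < t \<longrightarrow>
    (LINT (x, v):{0..L} \<times> {-M..M}|lebesgue. f\<^sub>h t x v)
      = (LINT (x, v):{0..L} \<times> {-M..M}|lebesgue. f\<^sub>0 x v)"
proof (intro ballI impI)
  fix t assume t: "t \<in> S" "0 < t"
  define mass where "mass s = (LINT (x, v):{0..L} \<times> {-M..M}|lebesgue. f\<^sub>h s x v)" for s
  note mX = \<open>mesh_partition 0 L Nx X\<close> and mV = \<open>mesh_partition (- M) M Nv V\<close>
  have Zh: "f\<^sub>h s \<in> Zh k Nx X Nv V" and Xh: "u\<^sub>h s \<in> Xh k Nx X" if "s \<in> S" for s
    using assms(14) that unfolding dg_solution_def by blast+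
  have diff: "(\<lambda>r. f\<^sub>h r x v) differentiable (at s within S)"
    if "s \<in> S" "i \<in> {1..Nx}" "j \<in> {1..Nv}" "x \<in> {X (i - 1)<..<X i}" "v \<in> {V (j - 1)<..<V j}"
    for s i j x v
    using assms(14) that unfolding dg_solution_def by blast
  have S1: "inner_\<Omega> L M (\<lambda>x v. vector_derivative (\<lambda>r. f\<^sub>h r x v) (at s within S)) (\<lambda>x v. 1)
      + (\<Sum>i=1..Nx. \<Sum>j=1..Nv. B_h lam1 lam2 Nx X Nv V i j (u\<^sub>h s) (f\<^sub>h s) (\<lambda>x v. 1)) = 0"
    if "s \<in> S" for s
    using assms(14) that const_one_in_Zh unfolding dg_solution_def by blast
  have "(mass has_real_derivative 0) (at s within S)" if s: "s \<in> S" for s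
  proof -
    \<comment> \<open>A solution interval containing \<open>0\<close> and \<open>t > 0\<close> has no isolated points.\<close>
    have "S \<noteq> {r}" for r
      using t \<open>0 \<in> S\<close> by auto
    then have "s islimpt S"
      using s \<open>is_interval S\<close> by (intro connected_imp_perfect is_interval_connected)
    then have "at s within S \<noteq> bot"
      by (simp add: trivial_limit_within)
    then have "(mass has_real_derivative
        (LINT (x, v):{0..L} \<times> {-M..M}|lebesgue. vector_derivative (\<lambda>r. f\<^sub>h r x v) (at s within S)))
        (at s within S)"
      unfolding mass_def using s Zh diff by (intro mesh_integral_time_derivative[OF mX mV])
    moreover have "(LINT (x, v):{0..L} \<times> {-M..M}|lebesgue.
        vector_derivative (\<lambda>r. f\<^sub>h r x v) (at s within S)) = 0"
      using S1[OF s] sum_B_h_const_one[OF mX mV Zh[OF s] Xh[OF s]] by (simp add: inner_\<Omega>_def)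
    ultimately show ?thesis
      by simp
  qed
  then obtain m where "\<And>s. s \<in> S \<Longrightarrow> mass s = m"
    using has_field_derivative_zero_constant[of S mass] \<open>is_interval S\<close>
    by (auto dest: is_interval_convex)
  then have "mass t = mass 0"
    using t \<open>0 \<in> S\<close> by simp
  also have "mass 0 = inner_\<Omega> L M (f\<^sub>h 0) (\<lambda>x v. 1)"
    by (simp add: mass_def inner_\<Omega>_def)
  also have "\<dots> = inner_\<Omega> L M f\<^sub>0 (\<lambda>x v. 1)"
    using assms(15) const_one_in_Zh unfolding is_L2_projection_def by blast
  also have "\<dots> = (LINT (x, v):{0..L} \<times> {-M..M}|lebesgue. f\<^sub>0 x v)"
    by (simp add: inner_\<Omega>_def)
  finally show "(LINT (x, v):{0..L} \<times> {-M..M}|lebesgue. f\<^sub>h t x v)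
      = (LINT (x, v):{0..L} \<times> {-M..M}|lebesgue. f\<^sub>0 x v)"
    by (simp add: mass_def)
qed

end
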